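(* Let $n\ge 1$ be an integer, let $d\in\{1,2\}$, and let $\mathcal{P}_0,\mathcal{P}_1,\ldots,\mathcal{P}_n\subset\mathbb{R}^d$ be polytopes. Suppose that all $\mathcal{P}_i$, $i\in N_0$, are nonempty and that at least one of them is full dimensional. Then $\mathcal{D}$ is exactly the set of points $\begin{pmatrix}x\\ z\end{pmatrix}\in\mathbb{R}^{d+n}$ that satisfy the full optimal big-M lifting of each facet-describing inequality of each $\mathcal{P}_i$, $i\in N_0$, together with the inequalities $\sum_{i\in N}z_i\le 1$ and $z_i\ge 0$ for $i\in N$.
   Context: Write $N=\{1,\ldots,n\}$ and $N_0=\{0,1,\ldots,n\}$. $\mathbf{e}_i$ denotes the $i$-th standard unit vector of $\mathbb{R}^n$ for $i\in N$, and $\mathbf{e}_0$ denotes the zero vector of $\mathbb{R}^n$. Points of $\mathbb{R}^{d+n}$ are written $\begin{pmatrix}x\\ z\end{pmatrix}$ with $x\in\mathbb{R}^d$, $z\in\mathbb{R}^n$. The polytope $\mathcal{D}$ is $$\mathcal{D}:=\operatorname{conv}\left(\bigcup_{i\in N_0}\left\{\begin{pmatrix}x\\ \mathbf{e}_i\end{pmatrix} : x\in\mathcal{P}_i\right\}\right)\subset\mathbb{R}^{d+n}.$$ Terminology: an inequality is valid for a polytope if all points of the polytope satisfy it; the face described by a valid inequality is the set of points of the polytope satisfying it with equality. The dimension of a polytope is one less than the maximum number of affinely independent points in it; a polytope in $\mathbb{R}^m$ is full dimensional if its dimension is $m$; a facet is a face of dimension one less than that of the polytope. A facet-describing inequality of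 a polytope is a valid inequality whose described face is a facet (for a full-dimensional polytope it is determined by the facet up to a positive multiple). Full optimal big-M lifting: let $\alpha^\top x\le\beta$ be valid for $\mathcal{P}_k$, $k\in N_0$, and for $i\in N_0\setminus\{k\}$ put $M_i:=\min\{\beta-\alpha^\top x : x\in\mathcal{P}_i\}$. If $k=0$, the full optimal big-M lifting of $\alpha^\top x\le\beta$ is the inequality $$\alpha^\top x+\sum_{i\in N}M_iz_i\le\beta.$$ If $k\in N$, it is the inequality $$\alpha^\top x+\sum_{i\in N\setminus\{k\}}(M_i-M_0)z_i-M_0z_k\le\beta-M_0.$$ *)

theory Defs
  imports "HOL-Analysis.Analysis"
begin

text \<open>The index type \<open>'n option\<close> plays the role of $N_0 = \{0, 1, \ldots, n\}$: \<open>None\<close> is the index $0$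
  and \<open>Some i\<close> is an index in $N$. The space $R^{d+n}$ is \<open>(real^'d) \<times> (real^'n)\<close>.\<close>

definition unit0 :: "'n::finite option \<Rightarrow> real^'n" where
  "unit0 i = (case i of None \<Rightarrow> 0 | Some j \<Rightarrow> axis j 1)"

definition disj_polytope :: "('n::finite option \<Rightarrow> (real^'d::finite) set) \<Rightarrow> ((real^'d) \<times> (real^'n)) set" where
  "disj_polytope P = convex hull (\<Union>i. {(x, unit0 i) | x. x \<in> P i})"

definition valid_ineq :: "'a::real_inner \<Rightarrow> real \<Rightarrow> 'a set \<Rightarrow> bool" where
  "valid_ineq \<alpha> \<beta> S \<longleftrightarrow> (\<forall>x\<in>S. \<alpha> \<bullet> x \<le> \<beta>)"

definition described_face :: "'a::real_inner \<Rightarrow> real \<Rightarrow> 'a set \<Rightarrow> 'a set" where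
  "described_face \<alpha> \<beta> S = {x\<in>S. \<alpha> \<bullet> x = \<beta>}"

text \<open>Since \<open>aff_dim {} = -1\<close>, the empty face counts as the facet of a single point. This is the
  only difference from the library's \<open>facet_of\<close>; see \<open>facet_describing_iff_facet_of\<close> below.\<close>

definition facet_describing :: "'a::euclidean_space \<Rightarrow> real \<Rightarrow> 'a set \<Rightarrow> bool" where
  "facet_describing \<alpha> \<beta> S \<longleftrightarrow>
     valid_ineq \<alpha> \<beta> S \<and> aff_dim (described_face \<alpha> \<beta> S) = aff_dim S - 1"

lemma facet_describing_iff_facet_of:
  assumes "convex S" "aff_dim S \<noteq> 0"
  shows "facet_describing \<alpha> \<beta> S \<longleftrightarrow> valid_ineq \<alpha> \<beta> S \<and> described_face \<alpha> \<beta> S facet_of S"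
proof -
  have eq: "described_face \<alpha> \<beta> S = S \<inter> {x. \<alpha> \<bullet> x = \<beta>}"
    by (auto simp: described_face_def)
  have "described_face \<alpha> \<beta> S face_of S" if "valid_ineq \<alpha> \<beta> S"
    unfolding eq
    by (rule face_of_Int_supporting_hyperplane_le[OF assms(1)])
       (use that in \<open>auto simp: valid_ineq_def\<close>)
  moreover have "described_face \<alpha> \<beta> S \<noteq> {}"
    if "aff_dim (described_face \<alpha> \<beta> S) = aff_dim S - 1"
    using that assms(2) by auto
  ultimately show ?thesis
    unfolding facet_describing_def facet_of_def by blast
qed

text \<open>The infimum below is attained on nonempty polytopes; see \<open>bigM_attained\<close> and \<open>bigM_le\<close>.\<close>

definition bigM :: "'a::real_inner \<Rightarrow> real \<Rightarrow> 'a set \<Rightarrow> real" where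
  "bigM \<alpha> \<beta> S = (INF x\<in>S. \<beta> - \<alpha> \<bullet> x)"

lemma bigM_attained:
  fixes S :: "'a::euclidean_space set"
  assumes "polytope S" "S \<noteq> {}"
  shows "\<exists>x\<in>S. bigM \<alpha> \<beta> S = \<beta> - \<alpha> \<bullet> x"
proof -
  have "continuous_on S (\<lambda>x. \<beta> - \<alpha> \<bullet> x)"
    by (intro continuous_intros)
  then obtain x where x: "x \<in> S" "\<forall>y\<in>S. \<beta> - \<alpha> \<bullet> x \<le> \<beta> - \<alpha> \<bullet> y"
    using continuous_attains_inf[OF polytope_imp_compact[OF assms(1)] assms(2)] by blast
  have "bigM \<alpha> \<beta> S = \<beta> - \<alpha> \<bullet> x"
    unfolding bigM_def by (rule cInf_eq_minimum) (use x in auto)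
  with x(1) show ?thesis by blast
qed

lemma bigM_le:
  fixes S :: "'a::euclidean_space set"
  assumes "polytope S" "x \<in> S"
  shows "bigM \<alpha> \<beta> S \<le> \<beta> - \<alpha> \<bullet> x"
proof -
  have "compact ((\<lambda>x. \<beta> - \<alpha> \<bullet> x) ` S)"
    by (intro compact_continuous_image continuous_intros polytope_imp_compact assms(1))
  then show ?thesis
    unfolding bigM_def
    by (intro cINF_lower assms(2) bounded_imp_bdd_below compact_imp_bounded)
qed

definition full_bigM_lifting ::
  "('n::finite option \<Rightarrow> (real^'d::finite) set) \<Rightarrow> 'n option \<Rightarrow> real^'d \<Rightarrow> real \<Rightarrow> real^'d \<Rightarrow> real^'n \<Rightarrow> bool" where
  "full_bigM_lifting P k \<alpha> \<beta> x z \<longleftrightarrow>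
    (let M = (\<lambda>i. bigM \<alpha> \<beta> (P i)) in
     case k of
       None \<Rightarrow> \<alpha> \<bullet> x + (\<Sum>i\<in>UNIV. M (Some i) * z $ i) \<le> \<beta>
     | Some j \<Rightarrow> \<alpha> \<bullet> x + (\<Sum>i\<in>UNIV - {j}. (M (Some i) - M None) * z $ i) - M None * z $ j
                   \<le> \<beta> - M None)"

end

theory Submission
  imports Defs
begin

text \<open>
  The weights of a point \<open>z\<close> are its barycentric coordinates in the simplex spanned by \<open>0\<close> and the
  unit vectors: \<open>z $ j\<close> for the index \<open>Some j\<close>, and \<open>1 - (\<Sum>i. z $ i)\<close> for \<open>None\<close>. Writing \<open>w\<close> for
  them, the slice of the disjunctive polytope over \<open>z\<close> is the weighted Minkowski sum
  \<open>Q = {\<Sum>i. w i *\<^sub>R p i | p i \<in> P i}\<close> if all \<open>w i\<close> are nonnegative, and empty otherwise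
  (\<open>mem_disj_polytope_iff\<close>). The support function of \<open>Q\<close> is \<open>H \<alpha> = (\<Sum>i. w i * h i \<alpha>)\<close>, where \<open>h i\<close> is
  the support function of \<open>P i\<close>. Since the optimal big-M coefficient is \<open>\<beta> - h i \<alpha>\<close>, the lifting of
  \<open>\<alpha> \<bullet> x \<le> \<beta>\<close> from \<open>P k\<close> says exactly \<open>\<alpha> \<bullet> x \<le> H \<alpha> + w k * (\<beta> - h k \<alpha>)\<close>
  (\<open>full_bigM_lifting_iff\<close>). So a lifting never cuts off a point of \<open>Q\<close>, and for \<open>\<beta> = h k \<alpha>\<close> it is the
  supporting inequality of \<open>Q\<close> in direction \<open>\<alpha>\<close>. What remains is that the facet normals of the
  \<open>P i\<close> suffice to describe \<open>Q\<close>. There are two cases.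

  Suppose first that all \<open>P i\<close> are full dimensional. Some weight is positive, so \<open>Q\<close> is full dimensional as
  well, and it is the intersection of its facet half-spaces. The face of \<open>Q\<close> in direction \<open>\<alpha>\<close> is the
  weighted sum of the faces of the \<open>P i\<close> in that direction. In the plane, each of those faces is a
  point or an edge, and a sum of points cannot be an edge; on the line, all of them are
  end points, which are facets. Hence each facet normal of
  \<open>Q\<close> is a facet normal of some \<open>P i\<close> (\<open>facet_normal_of_minkowski_comb\<close>). This is where the bound
  on the dimension is essential: in dimension three, two edges can add up to a facet.

  Suppose now that some \<open>P k\<close> is not full dimensional, hence a point or a segment. Then \<open>Q\<close> may be lower
  dimensional, but \<open>P k\<close> has so many facet-describing inequalities that their liftings imply the
  supporting inequality of \<open>Q\<close> in every direction (\<open>all_directions_if_low_dim_summand\<close>), and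
  separation finishes the proof. For a point, the facet is empty, every strictly valid inequality
  describes it, and \<open>\<beta>\<close> can be taken arbitrarily close to \<open>h k \<alpha>\<close>. For a segment, every direction
  not orthogonal to it is a facet normal, and such directions are dense.
\<close>

section \<open>Support functions\<close>

definition support_fun :: "'a::real_inner set \<Rightarrow> 'a \<Rightarrow> real" where
  "support_fun S \<alpha> = (SUP x\<in>S. \<alpha> \<bullet> x)"

lemma support_fun_upper:
  fixes S :: "'a::euclidean_space set"
  assumes "polytope S" "x \<in> S"
  shows "\<alpha> \<bullet> x \<le> support_fun S \<alpha>"
proof -
  have "compact ((\<lambda>x. \<alpha> \<bullet> x) ` S)"
    by (intro compact_continuous_image continuous_intros polytope_imp_compact assms(1))
  then show ?thesis
    unfolding support_fun_def
    by (intro cSUP_upper assms(2) bounded_imp_bdd_above compact_imp_bounded)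
qed

lemma bigM_eq_support_fun:
  fixes S :: "'a::euclidean_space set"
  assumes "polytope S" "S \<noteq> {}"
  shows "bigM \<alpha> \<beta> S = \<beta> - support_fun S \<alpha>"
proof -
  obtain x where x: "x \<in> S" "bigM \<alpha> \<beta> S = \<beta> - \<alpha> \<bullet> x"
    using bigM_attained[OF assms] by blast
  have "support_fun S \<alpha> = \<alpha> \<bullet> x"
    unfolding support_fun_def
  proof (rule cSup_eq_maximum)
    show "y \<le> \<alpha> \<bullet> x" if y: "y \<in> (\<lambda>x. \<alpha> \<bullet> x) ` S" for y
    proof -
      obtain s where "s \<in> S" "y = \<alpha> \<bullet> s" using y by auto
      then show ?thesis using bigM_le[OF assms(1), of s \<alpha> \<beta>] x(2) by simp
    qed
  qed (use x(1) in auto)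
  with x(2) show ?thesis by simp
qed

lemma support_fun_attained:
  fixes S :: "'a::euclidean_space set"
  assumes "polytope S" "S \<noteq> {}"
  obtains x where "x \<in> S" "\<alpha> \<bullet> x = support_fun S \<alpha>"
proof -
  obtain x where "x \<in> S" "bigM \<alpha> 0 S = 0 - \<alpha> \<bullet> x"
    using bigM_attained[OF assms] by blast
  with bigM_eq_support_fun[OF assms, of \<alpha> 0] that show ?thesis by simp
qed

lemma support_fun_add_scaled_le:
  fixes S :: "'a::euclidean_space set"
  assumes "polytope S" "S \<noteq> {}" "0 \<le> t"
  shows "support_fun S (\<alpha> + t *\<^sub>R v) \<le> support_fun S \<alpha> + t * support_fun S v"
proof -
  obtain x where x: "x \<in> S" "(\<alpha> + t *\<^sub>R v) \<bullet> x = support_fun S (\<alpha> + t *\<^sub>R v)"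
    using support_fun_attained[OF assms(1,2)] .
  have "\<alpha> \<bullet> x + t * (v \<bullet> x) \<le> support_fun S \<alpha> + t * support_fun S v"
    by (intro add_mono mult_left_mono support_fun_upper assms x(1))
  then show ?thesis using x(2) by (simp add: inner_add_left)
qed

lemma facet_describing_support_fun:
  fixes S :: "'a::euclidean_space set"
  assumes "polytope S"
    and "aff_dim (described_face \<alpha> (support_fun S \<alpha>) S) = aff_dim S - 1"
  shows "facet_describing \<alpha> (support_fun S \<alpha>) S"
  using assms support_fun_upper[OF assms(1)]
  by (auto simp: facet_describing_def valid_ineq_def)

section \<open>Weighted Minkowski sums\<close>

definition minkowski_comb :: "('i::finite \<Rightarrow> real) \<Rightarrow> ('i \<Rightarrow> 'a::real_vector set) \<Rightarrow> 'a set" where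
  "minkowski_comb w P = {\<Sum>i\<in>UNIV. w i *\<^sub>R p i | p. \<forall>i. p i \<in> P i}"

lemma inner_sum_scaled:
  fixes \<alpha> :: "'a::real_inner"
  shows "\<alpha> \<bullet> (\<Sum>i\<in>I. w i *\<^sub>R p i) = (\<Sum>i\<in>I. w i * (\<alpha> \<bullet> p i))"
  by (simp add: inner_sum_right)

lemma minkowski_comb_inner_le:
  fixes P :: "'i::finite \<Rightarrow> 'a::euclidean_space set"
  assumes "\<And>i. polytope (P i)" "\<And>i. 0 \<le> w i" "x \<in> minkowski_comb w P"
  shows "\<alpha> \<bullet> x \<le> (\<Sum>i\<in>UNIV. w i * support_fun (P i) \<alpha>)"
proof -
  obtain p where p: "\<forall>i. p i \<in> P i" "x = (\<Sum>i\<in>UNIV. w i *\<^sub>R p i)"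
    using assms(3) by (auto simp: minkowski_comb_def)
  show ?thesis
    unfolding p(2) inner_sum_scaled
    by (intro sum_mono mult_left_mono support_fun_upper assms p(1)[rule_format])
qed

text \<open>Maximizing over each summand independently shows that \<open>minkowski_comb_inner_le\<close> is sharp: the support
  function of a weighted Minkowski sum is the weighted sum of the support functions.\<close>

lemma minkowski_comb_inner_attained:
  fixes P :: "'i::finite \<Rightarrow> 'a::euclidean_space set"
  assumes "\<And>i. polytope (P i)" "\<And>i. P i \<noteq> {}"
  obtains x where "x \<in> minkowski_comb w P" "\<alpha> \<bullet> x = (\<Sum>i\<in>UNIV. w i * support_fun (P i) \<alpha>)"
proof -
  have "\<forall>i. \<exists>q. q \<in> P i \<and> \<alpha> \<bullet> q = support_fun (P i) \<alpha>"
    using support_fun_attained[OF assms] by metis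
  then obtain p where p: "\<And>i. p i \<in> P i" "\<And>i. \<alpha> \<bullet> p i = support_fun (P i) \<alpha>"
    by metis
  show thesis
  proof (rule that)
    show "(\<Sum>i\<in>UNIV. w i *\<^sub>R p i) \<in> minkowski_comb w P"
      using p(1) by (auto simp: minkowski_comb_def)
    show "\<alpha> \<bullet> (\<Sum>i\<in>UNIV. w i *\<^sub>R p i) = (\<Sum>i\<in>UNIV. w i * support_fun (P i) \<alpha>)"
      by (simp add: inner_sum_scaled p(2))
  qed
qed

lemma polytope_minkowski_comb:
  fixes P :: "'i::finite \<Rightarrow> 'a::euclidean_space set"
  assumes "\<And>i. polytope (P i)"
  shows "polytope (minkowski_comb w P)"
proof -
  have "minkowski_comb w P = (\<Sum>i\<in>UNIV. (*\<^sub>R) (w i) ` P i)" (is "_ = ?S")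
  proof
    show "minkowski_comb w P \<subseteq> ?S"
      by (auto simp: minkowski_comb_def set_sum_alt)
    show "?S \<subseteq> minkowski_comb w P"
    proof
      fix x assume "x \<in> ?S"
      then obtain s where s: "x = sum s UNIV" "\<forall>i. s i \<in> (*\<^sub>R) (w i) ` P i"
        by (auto simp: set_sum_alt)
      then obtain p where "\<And>i. p i \<in> P i" "\<And>i. s i = w i *\<^sub>R p i"
        unfolding image_iff Bex_def by metis
      with s(1) show "x \<in> minkowski_comb w P"
        by (auto simp: minkowski_comb_def)
    qed
  qed
  moreover have "\<forall>i. \<exists>V. finite V \<and> (*\<^sub>R) (w i) ` P i = convex hull V"
    using polytope_scaling[OF assms] by (simp add: polytope_def)
  then obtain V where "\<And>i. finite (V i)" "\<And>i. (*\<^sub>R) (w i) ` P i = convex hull V i"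
    by metis
  ultimately show ?thesis
    by (auto simp: polytope_def convex_hull_set_sum[symmetric] intro!: exI[of _ "\<Sum>i\<in>UNIV. V i"] finite_set_sum)
qed

text \<open>Fixing the points in all other summands leaves a translated, scaled copy of \<open>P j\<close> in the
  sum.\<close>

lemma aff_dim_summand_le_minkowski_comb:
  fixes P :: "'i::finite \<Rightarrow> 'a::euclidean_space set"
  assumes "\<And>i. P i \<noteq> {}" "w j \<noteq> 0"
  shows "aff_dim (P j) \<le> aff_dim (minkowski_comb w P)"
proof -
  have "\<forall>i. \<exists>q. q \<in> P i" using assms(1) by blast
  then obtain q where q: "\<And>i. q i \<in> P i" by metis
  let ?c = "\<Sum>i\<in>UNIV-{j}. w i *\<^sub>R q i"
  have "(+) ?c ` (*\<^sub>R) (w j) ` P j \<subseteq> minkowski_comb w P"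
  proof clarify
    fix y assume y: "y \<in> P j"
    have "(\<Sum>i\<in>UNIV. w i *\<^sub>R (q(j:=y)) i) = ?c + w j *\<^sub>R y"
      by (subst sum.remove[of UNIV j]) (auto simp: add.commute intro!: arg_cong2[of _ _ _ _ "(+)"] sum.cong)
    then show "?c + w j *\<^sub>R y \<in> minkowski_comb w P"
      unfolding minkowski_comb_def using q y by (auto intro!: exI[of _ "q(j:=y)"])
  qed
  then have "aff_dim ((+) ?c ` (*\<^sub>R) (w j) ` P j) \<le> aff_dim (minkowski_comb w P)"
    by (rule aff_dim_subset)
  moreover have "inj ((*\<^sub>R) (w j) :: 'a \<Rightarrow> 'a)"
    using assms(2) by (auto simp: inj_on_def)
  ultimately show ?thesis
    by (simp add: aff_dim_translation_eq aff_dim_injective_linear_image)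
qed

lemma mem_minkowski_comb_if_all_directions:
  fixes P :: "'i::finite \<Rightarrow> 'a::euclidean_space set"
  assumes "\<And>i. polytope (P i)" "\<And>i. P i \<noteq> {}"
    and le: "\<And>\<alpha>. \<alpha> \<bullet> x \<le> (\<Sum>i\<in>UNIV. w i * support_fun (P i) \<alpha>)"
  shows "x \<in> minkowski_comb w P"
proof (rule ccontr)
  assume "x \<notin> minkowski_comb w P"
  moreover have "polytope (minkowski_comb w P)"
    by (rule polytope_minkowski_comb) fact
  ultimately obtain c b where cb: "c \<bullet> x < b" "\<And>y. y \<in> minkowski_comb w P \<Longrightarrow> b < c \<bullet> y"
    using separating_hyperplane_closed_point[of "minkowski_comb w P" x]
      polytope_imp_convex polytope_imp_closed by blast
  obtain y where y: "y \<in> minkowski_comb w P"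
      "(- c) \<bullet> y = (\<Sum>i\<in>UNIV. w i * support_fun (P i) (- c))"
    using minkowski_comb_inner_attained[OF assms(1,2)] .
  with cb(1) cb(2)[OF y(1)] le[of "- c"] show False by simp
qed

section \<open>Facets of planar Minkowski sums\<close>

lemma violated_facet_of_full_dim_polytope:
  fixes Q :: "'a::euclidean_space set"
  assumes "polytope Q" "aff_dim Q = DIM('a)" "x \<notin> Q"
  obtains \<alpha> \<beta> where "\<alpha> \<noteq> 0" "\<beta> < \<alpha> \<bullet> x" "valid_ineq \<alpha> \<beta> Q" "described_face \<alpha> \<beta> Q facet_of Q"
proof -
  obtain F where F: "finite F" "Q = (affine hull Q) \<inter> \<Inter>F"
      "\<forall>h\<in>F. \<exists>a b. a \<noteq> 0 \<and> h = {x. a \<bullet> x \<le> b}"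
      "\<And>F'. F' \<subset> F \<Longrightarrow> Q \<subset> (affine hull Q) \<inter> \<Inter>F'"
    using polytope_imp_polyhedron[OF assms(1)] unfolding polyhedron_Int_affine_minimal by blast
  obtain a b where ab: "\<And>h. h \<in> F \<Longrightarrow> a h \<noteq> 0 \<and> h = {x. a h \<bullet> x \<le> b h}"
    using F(3) by metis
  have "affine hull Q = UNIV"
    using assms(2) by (simp add: aff_dim_eq_full)
  then have Q: "Q = \<Inter>F" using F(2) by simp
  then obtain h where h: "h \<in> F" "x \<notin> h" using assms(3) by auto
  show thesis
  proof (rule that)
    show "a h \<noteq> 0" "b h < a h \<bullet> x" using ab[OF h(1)] h(2) by auto
    show "valid_ineq (a h) (b h) Q"
      using Q ab[OF h(1)] h(1) by (auto simp: valid_ineq_def)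
    have "Q \<inter> {x. a h \<bullet> x = b h} facet_of Q"
      using facet_of_polyhedron_explicit[OF F(1,2) ab F(4)] h(1) by blast
    moreover have "described_face (a h) (b h) Q = Q \<inter> {x. a h \<bullet> x = b h}"
      by (auto simp: described_face_def)
    ultimately show "described_face (a h) (b h) Q facet_of Q" by simp
  qed
qed

lemma described_face_support_fun_nonempty:
  fixes S :: "'a::euclidean_space set"
  assumes "polytope S" "S \<noteq> {}"
  shows "described_face \<alpha> (support_fun S \<alpha>) S \<noteq> {}"
  using support_fun_attained[OF assms, of \<alpha>] by (auto simp: described_face_def)

text \<open>A sum that is maximal in direction \<open>\<alpha>\<close> consists of terms that are maximal, because no term
  can make up for the loss in another. Terms of weight zero are unconstrained.\<close>

lemma minkowski_comb_face_summands:
  fixes P :: "'i::finite \<Rightarrow> 'a::euclidean_space set"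
  assumes P: "\<And>i. polytope (P i)" "\<And>i. 0 \<le> w i"
    and p: "\<And>i. p i \<in> P i"
    and eq: "\<alpha> \<bullet> (\<Sum>i\<in>UNIV. w i *\<^sub>R p i) = (\<Sum>i\<in>UNIV. w i * support_fun (P i) \<alpha>)"
    and "w j \<noteq> 0"
  shows "p j \<in> described_face \<alpha> (support_fun (P j) \<alpha>) (P j)"
proof -
  have nonneg: "0 \<le> w i * (support_fun (P i) \<alpha> - \<alpha> \<bullet> p i)" for i
    by (intro mult_nonneg_nonneg) (simp_all add: P p support_fun_upper)
  have "(\<Sum>i\<in>UNIV. w i * (support_fun (P i) \<alpha> - \<alpha> \<bullet> p i)) = 0"
    using eq by (simp add: inner_sum_scaled right_diff_distrib sum_subtractf)
  then have "w j * (support_fun (P j) \<alpha> - \<alpha> \<bullet> p j) = 0"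
    using nonneg by (simp add: sum_nonneg_eq_0_iff)
  with \<open>w j \<noteq> 0\<close> p show ?thesis by (simp add: described_face_def)
qed

text \<open>The faces \<open>F i\<close> of the summands in direction \<open>\<alpha>\<close> lie in hyperplanes, so they have dimension
  at most \<open>DIM('a) - 1 \<le> 1\<close>. If none were a facet, all would be single points, and so would be the
  face of the sum, which therefore could be a facet only in dimension one; but there single points
  are facets of the summands.\<close>

lemma facet_normal_of_minkowski_comb:
  fixes P :: "'i::finite \<Rightarrow> 'a::euclidean_space set"
  assumes dim: "DIM('a) \<le> 2"
    and P: "\<And>i. polytope (P i)" "\<And>i. P i \<noteq> {}" "\<And>i. aff_dim (P i) = DIM('a)"
    and w: "\<And>i. 0 \<le> w i"
    and \<alpha>: "\<alpha> \<noteq> 0"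
    and facet: "aff_dim (described_face \<alpha> (\<Sum>i\<in>UNIV. w i * support_fun (P i) \<alpha>) (minkowski_comb w P))
      = int DIM('a) - 1"
  obtains j where "facet_describing \<alpha> (support_fun (P j) \<alpha>) (P j)"
proof (rule ccontr)
  assume none: "\<not> thesis"
  define F where "F i = described_face \<alpha> (support_fun (P i) \<alpha>) (P i)" for i
  have "aff_dim (F i) \<le> aff_dim {x. \<alpha> \<bullet> x = support_fun (P i) \<alpha>}" for i
    by (rule aff_dim_subset) (auto simp: F_def described_face_def)
  then have upper: "aff_dim (F i) \<le> int DIM('a) - 1" for i
    using \<alpha> by (simp add: of_nat_diff)
  have proper: "aff_dim (F i) \<noteq> int DIM('a) - 1" for i
    using none that facet_describing_support_fun[OF P(1), of \<alpha> i] P(3)[of i] by (auto simp: F_def)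
  have ne: "0 \<le> aff_dim (F i)" for i
    using described_face_support_fun_nonempty[OF P(1,2)]
    by (metis F_def aff_dim_negative_iff linorder_not_less)
  have "aff_dim (F i) = 0" for i
    using upper[of i] proper[of i] ne[of i] dim by linarith
  then have "\<forall>i. \<exists>q. F i = {q}" by (simp add: aff_dim_eq_0)
  then obtain q where q: "\<And>i. F i = {q i}" by metis
  have "described_face \<alpha> (\<Sum>i\<in>UNIV. w i * support_fun (P i) \<alpha>) (minkowski_comb w P)
      \<subseteq> {\<Sum>i\<in>UNIV. w i *\<^sub>R q i}"
  proof
    fix y assume y: "y \<in> described_face \<alpha> (\<Sum>i\<in>UNIV. w i * support_fun (P i) \<alpha>) (minkowski_comb w P)"
    then obtain p where p: "\<And>i. p i \<in> P i" "y = (\<Sum>i\<in>UNIV. w i *\<^sub>R p i)"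
      by (auto simp: described_face_def minkowski_comb_def)
    have "w i = 0 \<or> p i = q i" for i
      using minkowski_comb_face_summands[of P w p \<alpha> i, OF P(1) w p(1)] y p(2) q[of i]
      by (auto simp: described_face_def F_def)
    then have "w i *\<^sub>R p i = w i *\<^sub>R q i" for i by (metis scaleR_zero_left)
    then show "y \<in> {\<Sum>i\<in>UNIV. w i *\<^sub>R q i}" by (simp only: p(2) singleton_iff)
  qed
  \<comment> \<open>The index type is nonempty, and any index leads to the contradiction.\<close>
  from aff_dim_subset[OF this] have "int DIM('a) - 1 \<le> 0" using facet by simp
  with upper[of undefined] proper[of undefined] ne[of undefined] show False by linarith
qed

section \<open>Directions available from a summand of lower dimension\<close>

text \<open>The facets of a segment are its end points. A linear functional that is not constant on the
  segment is maximal at exactly one of them.\<close>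

lemma facet_describing_if_aff_dim_1:
  fixes S :: "'a::euclidean_space set"
  assumes "polytope S" "aff_dim S = 1" "u \<in> S" "v \<in> S" "\<alpha> \<bullet> u \<noteq> \<alpha> \<bullet> v"
  shows "facet_describing \<alpha> (support_fun S \<alpha>) S"
proof -
  let ?F = "described_face \<alpha> (support_fun S \<alpha>) S"
  have "S \<inter> {x. \<alpha> \<bullet> x = support_fun S \<alpha>} face_of S"
    using assms(1) support_fun_upper[OF assms(1)]
    by (intro face_of_Int_supporting_hyperplane_le polytope_imp_convex) auto
  then have "?F face_of S"
    by (simp add: described_face_def Int_def)
  moreover have "?F \<noteq> S"
  proof
    assume "?F = S"
    then have "\<alpha> \<bullet> y = support_fun S \<alpha>" if "y \<in> S" for y
      using that unfolding described_face_def by blast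
    with assms(3-5) show False by simp
  qed
  ultimately have "aff_dim ?F < aff_dim S"
    using face_of_aff_dim_lt polytope_imp_convex assms(1) by blast
  moreover have "?F \<noteq> {}"
    using described_face_support_fun_nonempty assms by blast
  then have "0 \<le> aff_dim ?F" by (metis aff_dim_negative_iff linorder_not_less)
  ultimately show ?thesis
    using assms(2) by (intro facet_describing_support_fun assms(1)) linarith
qed

lemma nonpos_if_le_all_multiples:
  fixes a b :: real
  assumes "\<And>t. 0 < t \<Longrightarrow> a \<le> t * b"
  shows "a \<le> 0"
proof (rule tendsto_lowerbound)
  show "((\<lambda>t. t * b) \<longlongrightarrow> 0) (at_right 0)"
    by (auto intro!: tendsto_eq_intros)
  show "\<forall>\<^sub>F t in at_right 0. a \<le> t * b"
    using assms by (auto intro: eventually_mono[OF eventually_at_right_less])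
qed simp

text \<open>The premise \<open>valid\<close> is the form that the liftings from \<open>P k\<close> take in terms of support
  functions. Both cases are limit arguments: if \<open>P k\<close> is a point, the slack \<open>\<beta> - support_fun (P k) \<alpha>\<close>
  can be any positive number; if it is a segment, a direction \<open>\<alpha>\<close> orthogonal to it is a limit of
  directions \<open>\<alpha> + t *\<^sub>R v\<close> that are not, and sublinearity of the support functions controls the
  error linearly in \<open>t\<close>.\<close>

lemma all_directions_if_low_dim_summand:
  fixes P :: "'i::finite \<Rightarrow> 'a::euclidean_space set"
  assumes P: "\<And>i. polytope (P i)" "\<And>i. P i \<noteq> {}"
    and w: "\<And>i. 0 \<le> w i"
    and dim: "aff_dim (P k) \<le> 1"
    and valid: "\<And>\<alpha> \<beta>. facet_describing \<alpha> \<beta> (P k) \<Longrightarrow>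
      \<alpha> \<bullet> x \<le> (\<Sum>i\<in>UNIV. w i * support_fun (P i) \<alpha>) + w k * (\<beta> - support_fun (P k) \<alpha>)"
  shows "\<alpha> \<bullet> x \<le> (\<Sum>i\<in>UNIV. w i * support_fun (P i) \<alpha>)"
proof -
  let ?H = "\<lambda>\<alpha>. \<Sum>i\<in>UNIV. w i * support_fun (P i) \<alpha>"
  have "aff_dim (P k) \<ge> 0"
    using P(2) by (metis aff_dim_negative_iff linorder_not_less)
  with dim consider "aff_dim (P k) = 0" | "aff_dim (P k) = 1" by linarith
  then show ?thesis
  proof cases
    case 1
    \<comment> \<open>The facet of a point is the empty face, so a facet-describing inequality has slack \<open>e > 0\<close>.\<close>
    have "\<alpha> \<bullet> x \<le> ?H \<alpha> + w k * e" if "e > 0" for e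
    proof -
      let ?b = "support_fun (P k) \<alpha> + e"
      have less: "\<alpha> \<bullet> y < ?b" if "y \<in> P k" for y
        using support_fun_upper[OF P(1) that, of \<alpha>] \<open>e > 0\<close> by linarith
      have empty: "described_face \<alpha> ?b (P k) = {}"
        using less by (fastforce simp: described_face_def)
      have "facet_describing \<alpha> ?b (P k)"
        unfolding facet_describing_def valid_ineq_def empty
        using less 1 by (auto simp: less_imp_le)
      from valid[OF this] show ?thesis by simp
    qed
    then have "\<alpha> \<bullet> x - ?H \<alpha> \<le> e * w k" if "e > 0" for e
      using that by (simp add: algebra_simps)
    then have "\<alpha> \<bullet> x - ?H \<alpha> \<le> 0" by (rule nonpos_if_le_all_multiples)
    then show ?thesis by simp
  next
    case 2
    then obtain p q where pq: "p \<in> P k" "q \<in> P k" "p \<noteq> q"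
      by (metis P(2) aff_dim_sing equals0I is_singletonI' is_singleton_def zero_neq_one)
    have generic: "\<alpha> \<bullet> x \<le> ?H \<alpha>" if "\<alpha> \<bullet> p \<noteq> \<alpha> \<bullet> q" for \<alpha>
      using valid[OF facet_describing_if_aff_dim_1[OF P(1) 2 pq(1,2) that]] by simp
    show ?thesis
    proof (cases "\<alpha> \<bullet> p = \<alpha> \<bullet> q")
      case True
      define v where "v = p - q"
      have "v \<bullet> v \<noteq> 0" using pq(3) by (simp add: v_def)
      have "\<alpha> \<bullet> x - ?H \<alpha> \<le> t * (?H v - v \<bullet> x)" if "t > 0" for t
      proof -
        have "(\<alpha> + t *\<^sub>R v) \<bullet> p - (\<alpha> + t *\<^sub>R v) \<bullet> q = t * (v \<bullet> v)"
          using True by (simp add: v_def algebra_simps)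
        then have "(\<alpha> + t *\<^sub>R v) \<bullet> p \<noteq> (\<alpha> + t *\<^sub>R v) \<bullet> q"
          using that \<open>v \<bullet> v \<noteq> 0\<close> by auto
        from generic[OF this] have "(\<alpha> + t *\<^sub>R v) \<bullet> x \<le> ?H (\<alpha> + t *\<^sub>R v)" .
        also have "\<dots> \<le> (\<Sum>i\<in>UNIV. w i * (support_fun (P i) \<alpha> + t * support_fun (P i) v))"
          using that by (intro sum_mono mult_left_mono support_fun_add_scaled_le P w) auto
        also have "\<dots> = ?H \<alpha> + t * ?H v"
          by (simp add: distrib_left sum.distrib sum_distrib_left mult.left_commute)
        finally show ?thesis by (simp add: algebra_simps)
      qed
      then have "\<alpha> \<bullet> x - ?H \<alpha> \<le> 0" by (rule nonpos_if_le_all_multiples)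
      then show ?thesis by simp
    qed (rule generic)
  qed
qed

section \<open>Slices of the disjunctive polytope and liftings\<close>

definition weight :: "real^'n \<Rightarrow> 'n::finite option \<Rightarrow> real" where
  "weight z i = (case i of None \<Rightarrow> 1 - (\<Sum>i\<in>UNIV. z $ i) | Some j \<Rightarrow> z $ j)"

lemma sum_UNIV_option:
  fixes f :: "'n::finite option \<Rightarrow> 'a::comm_monoid_add"
  shows "(\<Sum>i\<in>UNIV. f i) = f None + (\<Sum>j\<in>UNIV. f (Some j))"
  by (simp add: UNIV_option_conv sum.reindex)

lemma sum_weight: "(\<Sum>i\<in>UNIV. weight z i) = 1"
  by (simp add: sum_UNIV_option weight_def)

lemma weight_nonneg_iff:
  "(\<forall>i. 0 \<le> weight z i) \<longleftrightarrow> (\<Sum>i\<in>UNIV. z $ i) \<le> 1 \<and> (\<forall>i. 0 \<le> z $ i)"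
  by (auto simp: weight_def split: option.split)

text \<open>The points \<open>unit0 i\<close> are affinely independent, so the coefficients of an affine combination are
  determined by its value.\<close>

lemma weight_eqI:
  assumes "(\<Sum>i\<in>UNIV. c i) = 1" "z = (\<Sum>i\<in>UNIV. c i *\<^sub>R unit0 i)"
  shows "weight z = c"
proof -
  have z: "z $ j = c (Some j)" for j
  proof -
    have "z $ j = (\<Sum>i\<in>UNIV. if i = j then c (Some i) else 0)"
      unfolding assms(2) sum_UNIV_option
      by (auto simp: unit0_def axis_def if_distrib cong: if_cong intro!: sum.cong)
    then show ?thesis by simp
  qed
  show ?thesis
    using assms(1) by (auto simp: fun_eq_iff weight_def z sum_UNIV_option split: option.split)
qed

lemma sum_weight_unit0: "(\<Sum>i\<in>UNIV. weight z i *\<^sub>R unit0 i) = z"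
proof -
  have "(\<Sum>i\<in>UNIV. weight z i *\<^sub>R unit0 i) $ j = z $ j" for j
  proof -
    have "(\<Sum>i\<in>UNIV. weight z i *\<^sub>R unit0 i) $ j = (\<Sum>i\<in>UNIV. if i = j then z $ i else 0)"
      unfolding sum_UNIV_option
      by (auto simp: unit0_def weight_def axis_def if_distrib cong: if_cong intro!: sum.cong)
    then show ?thesis by simp
  qed
  then show ?thesis by (simp add: vec_eq_iff)
qed

text \<open>A point of the convex hull is a convex combination of one point \<open>(p i, unit0 i)\<close> for each \<open>i\<close>,
  because the pieces are convex. Its second component determines the coefficients, so for a fixed \<open>z\<close> only
  the choice of the \<open>p i\<close> remains.\<close>

lemma mem_disj_polytope_iff:
  fixes P :: "'n::finite option \<Rightarrow> (real^'d::finite) set"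
  assumes "\<And>i. polytope (P i)" "\<And>i. P i \<noteq> {}"
  shows "(x, z) \<in> disj_polytope P \<longleftrightarrow> (\<forall>i. 0 \<le> weight z i) \<and> x \<in> minkowski_comb (weight z) P"
proof -
  let ?S = "\<lambda>i. P i \<times> {unit0 i}"
  have S: "{(x, unit0 i) | x. x \<in> P i} = ?S i" for i by auto
  have "\<forall>i\<in>UNIV. convex (?S i) \<and> ?S i \<noteq> {}"
    using assms by (simp add: convex_Times polytope_imp_convex)
  from convex_hull_finite_union[OF finite this]
  have hull: "disj_polytope P = {\<Sum>i\<in>UNIV. c i *\<^sub>R s i | c s.
      (\<forall>i. 0 \<le> c i) \<and> sum c UNIV = 1 \<and> (\<forall>i. s i \<in> ?S i)}"
    unfolding disj_polytope_def S by simp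
  show ?thesis
  proof
    assume "(x, z) \<in> disj_polytope P"
    then obtain c s where cs: "(x, z) = (\<Sum>i\<in>UNIV. c i *\<^sub>R s i)" "\<And>i. 0 \<le> c i"
        "sum c UNIV = 1" "\<And>i. s i \<in> ?S i"
      unfolding hull by blast
    have s: "snd (s i) = unit0 i" "fst (s i) \<in> P i" for i
      using cs(4)[of i] by auto
    have x: "x = (\<Sum>i\<in>UNIV. c i *\<^sub>R fst (s i))"
      using arg_cong[OF cs(1), of fst] by (simp add: fst_sum)
    have "z = (\<Sum>i\<in>UNIV. c i *\<^sub>R unit0 i)"
      using arg_cong[OF cs(1), of snd] by (simp add: snd_sum s(1))
    then have "weight z = c" by (intro weight_eqI cs(3))
    with x cs(2) s(2) show "(\<forall>i. 0 \<le> weight z i) \<and> x \<in> minkowski_comb (weight z) P"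
      by (auto simp: minkowski_comb_def)
  next
    assume R: "(\<forall>i. 0 \<le> weight z i) \<and> x \<in> minkowski_comb (weight z) P"
    then obtain p where p: "\<And>i. p i \<in> P i" "x = (\<Sum>i\<in>UNIV. weight z i *\<^sub>R p i)"
      by (auto simp: minkowski_comb_def)
    have "(x, z) = (\<Sum>i\<in>UNIV. weight z i *\<^sub>R (p i, unit0 i))"
      by (simp add: prod_eq_iff fst_sum snd_sum p(2) sum_weight_unit0)
    then show "(x, z) \<in> disj_polytope P"
      unfolding hull mem_Collect_eq
      using R p(1) sum_weight[of z]
      by (intro exI[of _ "weight z"] exI[of _ "\<lambda>i. (p i, unit0 i)"]) simp
  qed
qed

text \<open>The two forms of the lifting, for \<open>k = None\<close> and for \<open>k = Some j\<close>, are one inequality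
  \<open>\<alpha> \<bullet> x \<le> w k * \<beta> + (\<Sum>i\<noteq>k. w i * support_fun (P i) \<alpha>)\<close> once the weight \<open>w None\<close> is eliminated by
  means of \<open>(\<Sum>i. w i) = 1\<close>. The last term below is the excess of \<open>\<beta>\<close> over the supporting value.\<close>

lemma full_bigM_lifting_iff:
  fixes P :: "'n::finite option \<Rightarrow> (real^'d::finite) set"
  assumes "\<And>i. polytope (P i)" "\<And>i. P i \<noteq> {}"
  shows "full_bigM_lifting P k \<alpha> \<beta> x z \<longleftrightarrow>
    \<alpha> \<bullet> x \<le> (\<Sum>i\<in>UNIV. weight z i * support_fun (P i) \<alpha>)
      + weight z k * (\<beta> - support_fun (P k) \<alpha>)"
proof (cases k)
  case None
  then show ?thesis
    by (simp add: full_bigM_lifting_def bigM_eq_support_fun[OF assms] sum_UNIV_option weight_def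
        algebra_simps sum_subtractf sum_distrib_left)
next
  case (Some j)
  have s: "(\<Sum>i\<in>UNIV. f i) = f j + (\<Sum>i\<in>UNIV-{j}. f i)" for f :: "'n \<Rightarrow> real"
    by (simp add: sum.remove[of UNIV j])
  show ?thesis
    by (simp add: Some full_bigM_lifting_def bigM_eq_support_fun[OF assms] sum_UNIV_option weight_def
        s algebra_simps sum_subtractf sum_distrib_left)
qed

section \<open>The description of the disjunctive polytope\<close>

theorem theorem6:
  fixes P :: "'n::finite option \<Rightarrow> (real^'d::finite) set"
  assumes "CARD('d) = 1 \<or> CARD('d) = 2"
    and "\<And>i. polytope (P i)"
    and "\<And>i. P i \<noteq> {}"
    and "\<exists>i. aff_dim (P i) = int CARD('d)"
  shows "disj_polytope P =
    {(x, z). (\<forall>k \<alpha> \<beta>. facet_describing \<alpha> \<beta> (P k) \<longrightarrow> full_bigM_lifting P k \<alpha> \<beta> x z)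
             \<and> (\<Sum>i\<in>UNIV. z $ i) \<le> 1
             \<and> (\<forall>i. 0 \<le> z $ i)}"
proof -
  have "(x, z) \<in> disj_polytope P \<longleftrightarrow>
      (\<forall>k \<alpha> \<beta>. facet_describing \<alpha> \<beta> (P k) \<longrightarrow> full_bigM_lifting P k \<alpha> \<beta> x z)
      \<and> (\<Sum>i\<in>UNIV. z $ i) \<le> 1 \<and> (\<forall>i. 0 \<le> z $ i)" (is "_ \<longleftrightarrow> ?L \<and> ?Z") for x z
  proof -
    let ?w = "weight z" and ?Q = "minkowski_comb (weight z) P"
    let ?H = "\<lambda>\<alpha>. \<Sum>i\<in>UNIV. ?w i * support_fun (P i) \<alpha>"
    have "x \<in> ?Q \<longleftrightarrow> ?L" if w: "\<And>i. 0 \<le> ?w i"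
    proof
      assume x: "x \<in> ?Q"
      show ?L
      proof (intro allI impI)
        fix k \<alpha> \<beta> assume facet: "facet_describing \<alpha> \<beta> (P k)"
        obtain p where "p \<in> P k" "\<alpha> \<bullet> p = support_fun (P k) \<alpha>"
          using support_fun_attained[OF assms(2,3)] .
        with facet have "support_fun (P k) \<alpha> \<le> \<beta>"
          by (auto simp: facet_describing_def valid_ineq_def)
        then have "0 \<le> ?w k * (\<beta> - support_fun (P k) \<alpha>)"
          using w by simp
        then show "full_bigM_lifting P k \<alpha> \<beta> x z"
          using minkowski_comb_inner_le[OF assms(2) w x, of \<alpha>]
          by (simp add: full_bigM_lifting_iff[OF assms(2,3)])
      qed
    next
      assume ?L
      then have L: "\<alpha> \<bullet> x \<le> ?H \<alpha> + ?w k * (\<beta> - support_fun (P k) \<alpha>)"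
        if "facet_describing \<alpha> \<beta> (P k)" for k \<alpha> \<beta>
        using that by (simp add: full_bigM_lifting_iff[OF assms(2,3)])
      show "x \<in> ?Q"
      proof (cases "\<exists>k. aff_dim (P k) \<noteq> int CARD('d)")
        case True
        then obtain k where "aff_dim (P k) \<noteq> int CARD('d)" ..
        \<comment> \<open>A deficit in dimension at most two leaves a point or a segment.\<close>
        then have "aff_dim (P k) \<le> 1"
          using aff_dim_le_DIM[of "P k"] assms(1) by auto
        from all_directions_if_low_dim_summand[OF assms(2,3) w this L]
        show ?thesis
          by (intro mem_minkowski_comb_if_all_directions assms(2,3))
      next
        case False
        then have full: "aff_dim (P i) = int DIM(real^'d)" for i by simp
        show ?thesis
        proof (rule ccontr)
          assume "x \<notin> ?Q"
          obtain j where "?w j \<noteq> 0"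
            using sum_weight[of z] by (metis sum.neutral zero_neq_one)
          then have dimQ: "aff_dim ?Q = int DIM(real^'d)"
            using aff_dim_summand_le_minkowski_comb[where w = ?w and P = P, OF assms(3)]
              full[of j] aff_dim_le_DIM[of ?Q] by (metis order_antisym)
          obtain \<alpha> \<beta> where ab: "\<alpha> \<noteq> 0" "\<beta> < \<alpha> \<bullet> x" "valid_ineq \<alpha> \<beta> ?Q"
              "described_face \<alpha> \<beta> ?Q facet_of ?Q"
            using violated_facet_of_full_dim_polytope
              [OF polytope_minkowski_comb[OF assms(2)] dimQ \<open>x \<notin> ?Q\<close>] .
          obtain y where y: "y \<in> ?Q" "\<alpha> \<bullet> y = \<beta>"
            using ab(4) by (auto simp: facet_of_def described_face_def)
          obtain u where u: "u \<in> ?Q" "\<alpha> \<bullet> u = ?H \<alpha>"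
            using minkowski_comb_inner_attained[OF assms(2,3)] .
          \<comment> \<open>The facet is nonempty, so its inequality is tight.\<close>
          have \<beta>: "\<beta> = ?H \<alpha>"
            using minkowski_comb_inner_le[OF assms(2) w y(1), of \<alpha>] y(2) u ab(3)
            by (fastforce simp: valid_ineq_def)
          have "DIM(real^'d) \<le> 2" using assms(1) by auto
          moreover have "aff_dim (described_face \<alpha> (?H \<alpha>) ?Q) = int DIM(real^'d) - 1"
            using ab(4) dimQ by (simp add: facet_of_def \<beta>)
          ultimately obtain i where "facet_describing \<alpha> (support_fun (P i) \<alpha>) (P i)"
            using facet_normal_of_minkowski_comb[where w = ?w and P = P, OF _ assms(2,3) full w ab(1)]
            by blast
          from L[OF this] ab(2) \<beta> show False by simp
        qed
      qed
    qed
    then show ?thesis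
      unfolding mem_disj_polytope_iff[OF assms(2,3)] weight_nonneg_iff[symmetric] by blast
  qed
  then show ?thesis by auto
qed

end
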